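(* Let $F$ be a (finite) confluence and let $f:F\to F$ be a closure operator on $F$. Then the set $f[F]$ of closed elements, with the order induced from $F$, is a confluence.
   Context: All ordered sets are finite. For an ordered set $E$ and $t\in E$, $E^t=\{x\in E : x\ge t\}$. A (finite) ordered set $F$ is a confluence if for every $t\in F$ the set $F^t$ (with the induced order) is a meet-semilattice with a greatest element; by finiteness, $F^t$ is then a lattice. A closure operator on an ordered set $E$ is a map $f:E\to E$ that is monotone, idempotent and extensive ($f(x)\ge x$). *)

theory Defs
  imports "HOL-Algebra.Lattice" "HOL-Library.FuncSet"
begin

definition induced_order ::
  "('a, 'b) gorder_scheme \<Rightarrow> 'a set \<Rightarrow> ('a, 'b) gorder_scheme"
  where "induced_order E A = E\<lparr>carrier := A\<rparr>"

definition up_set :: "('a, 'b) gorder_scheme \<Rightarrow> 'a \<Rightarrow> 'a set"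
  where "up_set E t = {x \<in> carrier E. t \<sqsubseteq>\<^bsub>E\<^esub> x}"

text \<open>\<^locale>\<open>partial_order\<close> forces the equality of the structure to be HOL equality, so
  \<^const>\<open>carrier\<close> and \<^const>\<open>le\<close> form an ordinary ordered set. The empty ordered set is a
  confluence.\<close>

locale confluence = partial_order F for F (structure) +
  assumes finite_carrier: "finite (carrier F)"
    and up_set_meet_semilattice:
      "t \<in> carrier F \<Longrightarrow> lower_semilattice (induced_order F (up_set F t))"
    and up_set_has_greatest:
      "t \<in> carrier F \<Longrightarrow> \<exists>g. greatest (induced_order F (up_set F t)) g (up_set F t)"

text \<open>Only the values of \<open>f\<close> on the carrier matter.\<close>

locale closure_operator = partial_order E for E (structure) and f :: "'a \<Rightarrow> 'a" +
  assumes maps_to: "f \<in> carrier E \<rightarrow> carrier E"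
    and mono: "Mono f"
    and idem: "Idem f"
    and extensive: "x \<in> carrier E \<Longrightarrow> x \<sqsubseteq> f x"

end

(* The closure operator f maps the up-set of t into itself, and the meet m there of two closed
   elements x, y is closed: f m lies below f x = x and f y = y, so f m \<le> m by maximality of m. The
   same argument makes the greatest element of the up-set closed. Hence both survive in f[F]. *)
theory Submission
  imports Defs
begin

lemma carrier_induced_order [simp]: "carrier (induced_order E A) = A"
  and le_induced_order [simp]: "le (induced_order E A) = le E"
  and eq_induced_order [simp]: "eq (induced_order E A) = eq E"
  by (simp_all add: induced_order_def)

text \<open>Restriction keeps the equality field of the record, which is HOL equality in
  \<open>L\<close>, so the restricted weak partial order is again an honest one.\<close>

lemma (in partial_order) partial_order_induced_order:
  assumes "A \<subseteq> carrier L"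
  shows "partial_order (induced_order L A)"
  using weak_partial_order_subset[OF weak_partial_order_axioms assms] eq_is_equal
  by (simp add: induced_order_def partial_order_def partial_order_axioms_def)

text \<open>Unpacks the meet in an up-set into inequalities of \<open>F\<close> itself, so that the
  same \<open>m\<close> can later be tested in the smaller up-set of closed elements.\<close>

lemma (in confluence) up_set_inf_exists:
  assumes "t \<in> carrier F" "x \<in> up_set F t" "y \<in> up_set F t"
  obtains m where "m \<in> up_set F t" "m \<sqsubseteq> x" "m \<sqsubseteq> y"
    "\<And>z. \<lbrakk>z \<in> up_set F t; z \<sqsubseteq> x; z \<sqsubseteq> y\<rbrakk> \<Longrightarrow> z \<sqsubseteq> m"
proof -
  interpret up: lower_semilattice "induced_order F (up_set F t)"
    using assms(1) by (rule up_set_meet_semilattice)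
  obtain m where "greatest (induced_order F (up_set F t)) m
      (Lower (induced_order F (up_set F t)) {x, y})"
    using up.inf_of_two_exists[of x y] assms by auto
  with assms show thesis
    by (intro that[of m]) (auto simp: greatest_def Lower_def)
qed

context closure_operator
begin

lemma closed_in_carrier: "x \<in> f ` carrier E \<Longrightarrow> x \<in> carrier E"
  using maps_to by auto

lemma image_closed: "x \<in> f ` carrier E \<Longrightarrow> f x = x"
  using idem eq_is_equal by (auto simp: idempotent_def)

lemma le_closed:
  assumes "x \<in> f ` carrier E" "z \<in> carrier E" "z \<sqsubseteq> x"
  shows "f z \<sqsubseteq> x"
  using use_iso1[OF mono, of z x] assms closed_in_carrier image_closed by metis

text \<open>Extensivity gives \<open>t\<close> \<le> \<open>z\<close> \<le>
  \<open>f z\<close>.\<close>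

lemma up_set_closed:
  assumes "t \<in> carrier E" "z \<in> up_set E t"
  shows "f z \<in> up_set E t"
proof -
  have "z \<in> carrier E" "f z \<in> carrier E"
    using assms maps_to by (auto simp: up_set_def)
  then show ?thesis
    using assms extensive[of z] le_trans[of t z "f z"] by (auto simp: up_set_def)
qed

text \<open>Extensivity supplies the reverse inequality, so antisymmetry makes \<open>z\<close> a
  fixed point. Closedness thus reduces to one inequality, which maximality of a meet or of a
  greatest element can deliver.\<close>

lemma closedI:
  assumes "z \<in> carrier E" "f z \<sqsubseteq> z"
  shows "z \<in> f ` carrier E"
proof -
  have "f z = z"
    using assms extensive[of z] maps_to weak_le_antisym[of "f z" z] eq_is_equal by auto
  then show ?thesis
    using assms by (metis imageI)
qed

end

theorem mainTheorem2:
  fixes F :: "('a, 'b) gorder_scheme" and f :: "'a \<Rightarrow> 'a"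
  assumes "confluence F"
    and "closure_operator F f"
  shows "confluence (induced_order F (f ` carrier F))"
proof -
  interpret confluence F by fact
  interpret closure_operator F f by fact
  let ?C = "f ` carrier F"
  let ?G = "induced_order F ?C"
  have in_up: "x \<in> up_set ?G t \<longleftrightarrow> x \<in> ?C \<and> x \<in> up_set F t" for x t
    using closed_in_carrier by (auto simp: up_set_def)
  \<comment> \<open>The second restriction overwrites the carrier set by the first, so every order
    below can be treated as a suborder of \<open>F\<close>.\<close>
  have induced: "induced_order ?G A = induced_order F A" for A
    by (simp add: induced_order_def)
  have po: "partial_order (induced_order F A)" if "A \<subseteq> ?C" for A
    using that closed_in_carrier by (intro partial_order_induced_order) auto
  show ?thesis
  proof (intro confluence.intro confluence_axioms.intro)
    show "partial_order ?G"
      by (rule po) simp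
  next
    show "finite (carrier ?G)"
      using finite_carrier by simp
  next
    fix t assume "t \<in> carrier ?G"
    then have t: "t \<in> carrier F" using closed_in_carrier by simp
    let ?U = "induced_order F (up_set ?G t)"
    \<comment> \<open>With the order axioms registered, only the existence of binary meets remains
      to be shown for the semilattice.\<close>
    interpret U: partial_order ?U
      by (rule po) (auto simp: in_up)
    have "lower_semilattice ?U"
    proof
      fix x y assume "x \<in> carrier ?U" "y \<in> carrier ?U"
      then have x: "x \<in> ?C" "x \<in> up_set F t" and y: "y \<in> ?C" "y \<in> up_set F t"
        by (simp_all add: in_up)
      obtain m where m: "m \<in> up_set F t" "m \<sqsubseteq>\<^bsub>F\<^esub> x" "m \<sqsubseteq>\<^bsub>F\<^esub> y"
        and max: "\<And>z. \<lbrakk>z \<in> up_set F t; z \<sqsubseteq>\<^bsub>F\<^esub> x; z \<sqsubseteq>\<^bsub>F\<^esub> y\<rbrakk> \<Longrightarrow> z \<sqsubseteq>\<^bsub>F\<^esub> m"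
        using up_set_inf_exists[OF t x(2) y(2)] by blast
      have mF: "m \<in> carrier F" using m(1) by (simp add: up_set_def)
      have "f m \<sqsubseteq>\<^bsub>F\<^esub> m"
        using up_set_closed[OF t m(1)] le_closed[OF x(1) mF m(2)] le_closed[OF y(1) mF m(3)]
        by (rule max)
      then have "m \<in> ?C" using mF by (rule closedI[rotated])
      \<comment> \<open>A closed lower bound of \<open>x\<close> and \<open>y\<close> above
        \<open>t\<close> is in particular a lower bound in the up-set of \<open>F\<close>, so
        \<open>max\<close> bounds it by \<open>m\<close>.\<close>
      then have "greatest ?U m (Lower ?U {x, y})"
        using x y m max by (auto simp: greatest_def Lower_def in_up)
      then show "\<exists>m. greatest ?U m (Lower ?U {x, y})" ..
    qed
    then show "lower_semilattice (induced_order ?G (up_set ?G t))"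
      by (simp only: induced)
    obtain g where g: "g \<in> up_set F t" and max: "\<And>z. z \<in> up_set F t \<Longrightarrow> z \<sqsubseteq>\<^bsub>F\<^esub> g"
      using up_set_has_greatest[OF t] by (auto simp: greatest_def)
    \<comment> \<open>\<open>f g\<close> stays in the up-set of \<open>t\<close>, so it lies below
      the greatest element \<open>g\<close>.\<close>
    have "g \<in> ?C"
      using g max[OF up_set_closed[OF t g]] by (intro closedI) (simp_all add: up_set_def)
    then have "greatest (induced_order ?G (up_set ?G t)) g (up_set ?G t)"
      using g max by (auto simp: greatest_def in_up)
    then show "\<exists>g. greatest (induced_order ?G (up_set ?G t)) g (up_set ?G t)" ..
  qed
qed

end
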